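(* Let $w$ be a nonempty string and $\varepsilon > 0$. Then there exists a positive integer $N$ such that for every integer $n \geq N$, \[ \frac{\rho(n)}{n} > \frac{\mathrm{run}(w^3) - \mathrm{run}(w^2)}{|w|} - \varepsilon. \]
   Context: A string is a finite sequence of symbols from a finite alphabet; $w[i]$ denotes its $i$-th symbol and $w[i:j]$ the substring from position $i$ to position $j$; $w^k$ is the concatenation of $k$ copies of $w$. A string $u$ has period $p$ if $u[i]=u[i+p]$ for $1\le i\le |u|-p$. A string $u$ is a run if its minimum period $p$ satisfies $p \leq |u|/2$. A substring $u = w[i:j]$ of $w$ is a run in $w$ if it is a run of (minimum) period $p$ and neither $w[i-1:j]$ nor $w[i:j+1]$ (whenever these exist) is a run of period $p$, i.e. the run is maximal. Runs are counted as distinct pairs of positions $(i,j)$. $\mathrm{run}(w)$ denotes the number of runs in $w$, and $\rho(n)$ denotes the maximum of $\mathrm{run}(x)$ over all strings $x$ of length $n$ (over any finite alphabet). *)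

theory Defs
  imports Complex_Main
begin

(* Positions of a string are 1-based, as in w[i:j]; list indexing with ! is 0-based.
   The substring is meant for 1 <= i <= j <= length w. *)
definition substring :: "'a list \<Rightarrow> nat \<Rightarrow> nat \<Rightarrow> 'a list" where
  "substring w i j = take (j + 1 - i) (drop (i - 1) w)"

(* Periods are positive; any p >= length u is vacuously a period, so the least
   period in min_period exists for every u (and is 1 for the empty string). *)
definition has_period :: "'a list \<Rightarrow> nat \<Rightarrow> bool" where
  "has_period u p \<longleftrightarrow> p > 0 \<and> (\<forall>i. i + p < length u \<longrightarrow> u ! i = u ! (i + p))"

definition min_period :: "'a list \<Rightarrow> nat" where
  "min_period u = (LEAST p. has_period u p)"

definition is_run :: "'a list \<Rightarrow> bool" where
  "is_run u \<longleftrightarrow> 2 * min_period u \<le> length u"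

definition is_run_of_period :: "'a list \<Rightarrow> nat \<Rightarrow> bool" where
  "is_run_of_period u p \<longleftrightarrow> is_run u \<and> min_period u = p"

definition run_in :: "'a list \<Rightarrow> nat \<Rightarrow> nat \<Rightarrow> bool" where
  "run_in w i j \<longleftrightarrow> 1 \<le> i \<and> i \<le> j \<and> j \<le> length w \<and>
     (\<exists>p. is_run_of_period (substring w i j) p \<and>
        (1 < i \<longrightarrow> \<not> is_run_of_period (substring w (i - 1) j) p) \<and>
        (j < length w \<longrightarrow> \<not> is_run_of_period (substring w i (j + 1)) p))"

definition num_runs :: "'a list \<Rightarrow> nat" where
  "num_runs w = card {(i, j). run_in w i j}"

(* A list uses only finitely many symbols, and every finite alphabet embeds into nat,
   so lists over nat cover the strings over all finite alphabets. The set of values is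
   finite because num_runs x <= (length x)^2. *)
definition max_runs :: "nat \<Rightarrow> nat" where
  "max_runs n = Max {num_runs x | x :: nat list. length x = n}"

definition str_power :: "'a list \<Rightarrow> nat \<Rightarrow> 'a list" where
  "str_power w k = concat (replicate k w)"

end

(* A substring of w^k of length at least 2|w| whose minimum period p is at most |w| forces
   the period p on the whole periodic word, so the only run of w^k that is this long is w^k
   itself. All other runs therefore depend only on a bounded neighbourhood of their starting
   position, and each further factor w contributes the same number of runs from k = 2 on.
   Arbitrary lengths n are reached by padding w^k with fresh letters, which destroys no run. *)

theory Submission
  imports Defs
begin

section \<open>Periods and substrings\<close>

lemma has_period_min_period: "has_period u (min_period u)"
proof -
  have "has_period u (Suc (length u))"
    by (simp add: has_period_def)
  then show ?thesis
    unfolding min_period_def by (rule LeastI)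
qed

lemma min_period_le: "has_period u p \<Longrightarrow> min_period u \<le> p"
  unfolding min_period_def by (rule Least_le)

lemma min_period_pos: "min_period u > 0"
  using has_period_min_period[of u] by (simp add: has_period_def)

lemma is_run_of_periodD:
  assumes "is_run_of_period u p"
  shows "has_period u p" "p > 0" "2 * p \<le> length u" "p = min_period u"
  using assms has_period_min_period[of u] min_period_pos[of u]
  by (auto simp: is_run_of_period_def is_run_def)

lemma substring_conv_map_nth:
  assumes "1 \<le> i" "j \<le> length w"
  shows "substring w i j = map ((!) w) [i - 1..<j]"
  using assms by (intro nth_equalityI) (auto simp: substring_def)

lemma set_substring_subset: "set (substring w i j) \<subseteq> set w"
  unfolding substring_def by (meson order_trans set_drop_subset set_take_subset)

lemma finite_runs: "finite {(i, j). run_in w i j}"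
  by (rule finite_subset[of _ "{..length w} \<times> {..length w}"]) (auto simp: run_in_def)

text \<open>A crude bound; it makes the set whose maximum is \<open>max_runs\<close> finite.\<close>

lemma num_runs_le: "num_runs w \<le> (length w + 1) * (length w + 1)"
proof -
  have "{(i, j). run_in w i j} \<subseteq> {..length w} \<times> {..length w}"
    by (auto simp: run_in_def)
  from card_mono[OF _ this] show ?thesis
    by (simp add: num_runs_def card_cartesian_product)
qed

section \<open>Renaming and adding letters\<close>

lemma has_period_map:
  assumes "inj_on f (set u)"
  shows "has_period (map f u) p \<longleftrightarrow> has_period u p"
  using assms by (auto simp: has_period_def inj_on_eq_iff)

lemma is_run_of_period_map:
  assumes "inj_on f (set u)"
  shows "is_run_of_period (map f u) p \<longleftrightarrow> is_run_of_period u p"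
  by (simp add: is_run_of_period_def is_run_def min_period_def has_period_map[OF assms])

text \<open>Periods see only equality of letters. This lets a word over \<open>'a\<close> be recoded
  over \<open>nat\<close>, the alphabet of \<open>max_runs\<close>.\<close>

lemma run_in_map:
  assumes "inj_on f (set w)"
  shows "run_in (map f w) i j \<longleftrightarrow> run_in w i j"
proof -
  have "is_run_of_period (substring (map f w) a b) p \<longleftrightarrow> is_run_of_period (substring w a b) p"
    for a b p
  proof -
    have "substring (map f w) a b = map f (substring w a b)"
      by (simp add: substring_def take_map drop_map)
    moreover have "inj_on f (set (substring w a b))"
      using assms set_substring_subset inj_on_subset by metis
    ultimately show ?thesis
      by (simp add: is_run_of_period_map)
  qed
  then show ?thesis
    by (simp add: run_in_def)
qed

lemma num_runs_map: "inj_on f (set w) \<Longrightarrow> num_runs (map f w) = num_runs w"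
  by (simp add: num_runs_def run_in_map)

text \<open>A run ending inside \<open>x\<close> keeps both its neighbours. A run ending at the end
  of \<open>x\<close> cannot be prolonged by \<open>c\<close>, since period \<open>p\<close> would
  equate \<open>c\<close> with a letter of \<open>x\<close>.\<close>

lemma run_in_snoc_fresh:
  assumes fresh: "c \<notin> set x" and run: "run_in x i j"
  shows "run_in (x @ [c]) i j"
proof -
  have ij: "1 \<le> i" "i \<le> j" "j \<le> length x"
    using run by (auto simp: run_in_def)
  obtain p where p: "is_run_of_period (substring x i j) p"
      "1 < i \<longrightarrow> \<not> is_run_of_period (substring x (i - 1) j) p"
      "j < length x \<longrightarrow> \<not> is_run_of_period (substring x i (j + 1)) p"
    using run by (auto simp: run_in_def)
  have eq: "substring (x @ [c]) a b = substring x a b" if "1 \<le> a" "b \<le> length x" for a b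
    using that by (intro nth_equalityI) (auto simp: substring_conv_map_nth nth_append)
  have "\<not> is_run_of_period (substring (x @ [c]) i (j + 1)) p"
  proof (cases "j < length x")
    case True
    then show ?thesis using p(3) ij eq[of i "j + 1"] by simp
  next
    case False
    then have j: "j = length x" using ij by simp
    show ?thesis
    proof
      let ?u = "substring (x @ [c]) i (j + 1)"
      assume r: "is_run_of_period ?u p"
      have u: "?u = map ((!) (x @ [c])) [i - 1..<j + 1]"
        using ij j by (intro substring_conv_map_nth) auto
      have len: "length ?u = j + 1 - (i - 1)"
        by (simp only: u length_map length_upt)
      have nth: "?u ! s = (x @ [c]) ! (i - 1 + s)" if "s < length ?u" for s
        using that unfolding u by (simp del: upt_Suc)
      note D = is_run_of_periodD[OF r]
      \<comment> \<open>The offset lying \<open>p\<close> before the final letter \<open>c\<close>;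
        \<open>2 * p \<le> length ?u\<close> keeps it in range.\<close>
      let ?t = "length ?u - 1 - p"
      have "?t + p < length ?u"
        using D len ij by linarith
      then have "?u ! ?t = ?u ! (?t + p)"
        using D(1) by (auto simp: has_period_def)
      moreover have "?u ! (?t + p) = c"
      proof -
        have "?t + p < length ?u" "i - 1 + (?t + p) = length x" using D(2,3) len ij j by linarith+
        then show ?thesis using nth[of "?t + p"] by simp
      qed
      moreover have "?u ! ?t = x ! (j - p)"
      proof -
        have "?t < length ?u" "i - 1 + ?t = j - p" "j - p < length x"
          using D(2,3) len ij j by linarith+
        then show ?thesis using nth[of ?t] by (simp add: nth_append)
      qed
      moreover have "j - p < length x" using D(2) ij j by linarith
      ultimately show False using fresh nth_mem by metis
    qed
  qed
  moreover have "is_run_of_period (substring (x @ [c]) i j) p"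
    using p(1) eq ij by simp
  moreover have "1 < i \<longrightarrow> \<not> is_run_of_period (substring (x @ [c]) (i - 1) j) p"
    using p(2) eq ij by simp
  ultimately show ?thesis
    using ij by (auto simp: run_in_def)
qed

lemma num_runs_snoc_fresh:
  assumes "c \<notin> set x"
  shows "num_runs x \<le> num_runs (x @ [c])"
  unfolding num_runs_def using run_in_snoc_fresh[OF assms]
  by (intro card_mono finite_runs) auto

lemma num_runs_le_max_runs: "num_runs (x :: nat list) \<le> max_runs (length x)"
  unfolding max_runs_def
proof (rule Max_ge)
  show "finite {num_runs y | y :: nat list. length y = length x}"
    by (rule finite_subset[of _ "{..(length x + 1) * (length x + 1)}"])
      (auto dest: sym intro!: order_trans[OF num_runs_le])
qed auto

text \<open>Pads \<open>x\<close> with \<open>d\<close> letters, each fresh for the word built so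
  far; \<open>nat\<close> always supplies one.\<close>

lemma num_runs_le_max_runs_add: "num_runs (x :: nat list) \<le> max_runs (length x + d)"
proof (induction d arbitrary: x)
  case 0
  then show ?case using num_runs_le_max_runs by simp
next
  case (Suc d)
  obtain c where c: "c \<notin> set x"
    using ex_new_if_finite infinite_UNIV_nat by blast
  have "num_runs x \<le> num_runs (x @ [c])" using num_runs_snoc_fresh[OF c] .
  also have "\<dots> \<le> max_runs (length x + Suc d)" using Suc[of "x @ [c]"] by simp
  finally show ?case .
qed

lemma num_runs_le_max_runs_length:
  fixes x :: "'a list"
  assumes "length x \<le> n"
  shows "num_runs x \<le> max_runs n"
proof -
  obtain f :: "'a \<Rightarrow> nat" where f: "inj_on f (set x)"
    using finite_imp_inj_to_nat_seg[of "set x"] by auto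
  show ?thesis
    using num_runs_le_max_runs_add[of "map f x" "n - length x"] assms num_runs_map[OF f] by simp
qed

section \<open>Runs in powers\<close>

lemma length_str_power: "length (str_power w k) = k * length w"
  by (induction k) (auto simp: str_power_def)

lemma nth_str_power:
  "t < k * length w \<Longrightarrow> str_power w k ! t = w ! (t mod length w)"
proof (induction k arbitrary: t)
  case (Suc k)
  then show ?case
    by (cases "t < length w") (auto simp: str_power_def nth_append le_mod_geq)
qed simp

text \<open>The factor at the 1-based positions i to j of the right-infinite power of w.\<close>

definition window :: "'a list \<Rightarrow> nat \<Rightarrow> nat \<Rightarrow> 'a list" where
  "window w i j = map (\<lambda>t. w ! (t mod length w)) [i - 1..<j]"

lemma length_window: "length (window w i j) = j - (i - 1)"
  by (simp add: window_def)

lemma nth_window: "t < j - (i - 1) \<Longrightarrow> window w i j ! t = w ! ((i - 1 + t) mod length w)"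
  by (simp add: window_def)

lemma substring_str_power:
  assumes "1 \<le> i" "j \<le> k * length w"
  shows "substring (str_power w k) i j = window w i j"
  using assms by (simp add: substring_conv_map_nth length_str_power window_def nth_str_power)

text \<open>At \<open>i = 0\<close> the truncated \<open>i - 1\<close> would not shift along with
  \<open>i\<close>, hence the hypothesis.\<close>

lemma window_shift: "1 \<le> i \<Longrightarrow> window w (i + length w) (j + length w) = window w i j"
proof (intro nth_equalityI)
  fix t assume i: "1 \<le> i" and "t < length (window w (i + length w) (j + length w))"
  moreover have "i + length w - 1 + t = i - 1 + t + length w" using i by simp
  ultimately show "window w (i + length w) (j + length w) ! t = window w i j ! t"
    by (simp only: length_window nth_window mod_add_self2)
qed (simp add: length_window)

text \<open>Runs of the right-infinite power of \<open>w\<close>: right maximality is demanded for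
  every \<open>j\<close>, so the notion does not depend on an exponent.\<close>

definition power_run :: "'a list \<Rightarrow> nat \<Rightarrow> nat \<Rightarrow> bool" where
  "power_run w i j \<longleftrightarrow> 1 \<le> i \<and> i \<le> j \<and>
     (\<exists>p. is_run_of_period (window w i j) p \<and>
        (1 < i \<longrightarrow> \<not> is_run_of_period (window w (i - 1) j) p) \<and>
        \<not> is_run_of_period (window w i (j + 1)) p)"

lemma run_in_str_power_iff:
  "run_in (str_power w k) i j \<longleftrightarrow> 1 \<le> i \<and> i \<le> j \<and> j \<le> k * length w \<and>
     (\<exists>p. is_run_of_period (window w i j) p \<and>
        (1 < i \<longrightarrow> \<not> is_run_of_period (window w (i - 1) j) p) \<and>
        (j < k * length w \<longrightarrow> \<not> is_run_of_period (window w i (j + 1)) p))"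
  unfolding run_in_def length_str_power
  by (intro conj_cong ex_cong1 imp_cong refl) (simp_all add: substring_str_power)

lemma run_in_str_power_interior:
  "j < k * length w \<Longrightarrow> run_in (str_power w k) i j \<longleftrightarrow> power_run w i j"
  by (simp add: run_in_str_power_iff power_run_def)

section \<open>Periods and runs of windows\<close>

lemma has_period_window_length: "w \<noteq> [] \<Longrightarrow> has_period (window w i j) (length w)"
  by (auto simp: has_period_def length_window nth_window simp flip: add.assoc)

lemma has_period_window_mono:
  assumes "has_period (window w i j) p" "i \<le> i'" "j' \<le> j"
  shows "has_period (window w i' j') p"
  unfolding has_period_def length_window
proof (intro conjI allI impI)
  show "p > 0" using assms(1) by (simp add: has_period_def)
  fix t assume t: "t + p < j' - (i' - 1)"
  define s where "s = (i' - 1) - (i - 1) + t"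
  have s: "i - 1 + s = i' - 1 + t" using assms(2) by (simp add: s_def)
  have sp: "s + p < j - (i - 1)" using t assms(3) s by linarith
  then have "window w i j ! s = window w i j ! (s + p)"
    using assms(1) by (simp add: has_period_def length_window)
  then show "window w i' j' ! t = window w i' j' ! (t + p)"
    using t sp s by (simp add: nth_window flip: add.assoc)
qed

text \<open>In a window of length at least \<open>length w + p\<close>, the first
  \<open>length w\<close> offsets meet every residue modulo \<open>length w\<close>, and each can be
  compared with the offset \<open>p\<close> further on. So \<open>w\<close> agrees cyclically with
  its shift by \<open>p\<close>, which no longer refers to the window.\<close>

lemma has_period_window_extend:
  assumes w: "w \<noteq> []" and per: "has_period (window w i j) p"
    and len: "length w + p \<le> j - (i - 1)"
  shows "has_period (window w i' j') p"
  unfolding has_period_def length_window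
proof (intro conjI allI impI)
  show "p > 0" using per by (simp add: has_period_def)
  let ?m = "length w"
  have m: "?m > 0" using w by simp
  have all: "w ! (x mod ?m) = w ! ((x + p) mod ?m)" for x
  proof -
    (* s is the offset in the given window of a position congruent to x modulo the length of w *)
    define s where "s = (x + (i - 1) * (?m - 1)) mod ?m"
    have "(i - 1 + s) mod ?m = (i - 1 + (x + (i - 1) * (?m - 1))) mod ?m"
      by (simp add: s_def mod_add_right_eq)
    \<comment> \<open>Adding \<open>(i - 1) * (?m - 1)\<close> subtracts \<open>i - 1\<close> modulo
      \<open>?m\<close> without truncated subtraction.\<close>
    also have "i - 1 + (x + (i - 1) * (?m - 1)) = x + (i - 1) * ?m"
    proof -
      obtain m' where "?m = Suc m'" using m gr0_implies_Suc by blast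
      then show ?thesis by simp
    qed
    finally have sx: "(i - 1 + s) mod ?m = x mod ?m" by simp
    have "s < ?m" using m by (simp add: s_def)
    then have sp: "s + p < j - (i - 1)" using len by linarith
    then have "window w i j ! s = window w i j ! (s + p)"
      using per by (simp add: has_period_def length_window)
    then have "w ! ((i - 1 + s) mod ?m) = w ! ((i - 1 + s + p) mod ?m)"
      using sp by (simp add: nth_window add.assoc)
    then show ?thesis
      using sx mod_add_cong[OF sx refl, of p] by metis
  qed
  fix t assume "t + p < j' - (i' - 1)"
  then show "window w i' j' ! t = window w i' j' ! (t + p)"
    using all[of "i' - 1 + t"] by (simp add: nth_window add.assoc)
qed

text \<open>Since \<open>p \<le> length w\<close>, the window is long enough for \<open>p\<close> to
  spread to the larger one. Conversely, every period of the larger window restricts to the smaller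
  one, so \<open>p\<close> stays minimal.\<close>

lemma is_run_of_period_window_extend:
  assumes w: "w \<noteq> []" and run: "is_run_of_period (window w i j) p"
    and len: "2 * length w \<le> j - (i - 1)" and sub: "i' \<le> i" "j \<le> j'"
  shows "is_run_of_period (window w i' j') p"
proof -
  note D = is_run_of_periodD[OF run]
  have "p \<le> length w"
    using D(4) min_period_le[OF has_period_window_length[OF w]] by simp
  then have "has_period (window w i' j') p"
    using has_period_window_extend[OF w D(1)] len by simp
  moreover have "p \<le> min_period (window w i' j')"
    using D(4) min_period_le has_period_window_mono[OF has_period_min_period sub] by metis
  ultimately have "min_period (window w i' j') = p"
    by (simp add: min_period_le order_antisym)
  moreover have "2 * p \<le> length (window w i' j')"
    using D(3) sub by (simp add: length_window)
  ultimately show ?thesis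
    by (simp add: is_run_of_period_def is_run_def)
qed

text \<open>A run of length at least \<open>2 * length w\<close> would extend with the same period
  to any neighbouring position, so by maximality it has no neighbours.\<close>

lemma run_in_str_power_short:
  assumes w: "w \<noteq> []" and run: "run_in (str_power w k) i j" and "(i, j) \<noteq> (1, k * length w)"
  shows "j + 1 < i + 2 * length w"
proof (rule ccontr)
  assume "\<not> ?thesis"
  moreover have ij: "1 \<le> i" "i \<le> j" "j \<le> k * length w"
    using run by (auto simp: run_in_str_power_iff)
  ultimately have len: "2 * length w \<le> j - (i - 1)" by linarith
  obtain p where p: "is_run_of_period (window w i j) p"
      "1 < i \<longrightarrow> \<not> is_run_of_period (window w (i - 1) j) p"
      "j < k * length w \<longrightarrow> \<not> is_run_of_period (window w i (j + 1)) p"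
    using run by (auto simp: run_in_str_power_iff)
  have "\<not> 1 < i" "\<not> j < k * length w"
    using p(2,3) is_run_of_period_window_extend[OF w p(1) len, of "i - 1" j]
      is_run_of_period_window_extend[OF w p(1) len, of i "j + 1"] by auto
  then show False
    using ij assms(3) by auto
qed

lemma run_in_str_power_full:
  assumes "w \<noteq> []" "k \<ge> 2"
  shows "run_in (str_power w k) 1 (k * length w)"
proof -
  let ?u = "window w 1 (k * length w)"
  have "min_period ?u \<le> length w"
    using assms(1) by (intro min_period_le has_period_window_length)
  moreover have "2 * length w \<le> k * length w"
    using assms(2) by simp
  ultimately have "is_run_of_period ?u (min_period ?u)"
    unfolding is_run_of_period_def is_run_def length_window by linarith
  moreover have "1 \<le> k * length w"
    using assms by (simp add: Suc_le_eq)
  ultimately show ?thesis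
    by (auto simp: run_in_str_power_iff)
qed

text \<open>Position 1 is excluded because it carries no left maximality condition, whereas its
  image does. The right end of the word moves along with \<open>j\<close>.\<close>

lemma run_in_str_power_shift:
  assumes "1 < i"
  shows "run_in (str_power w (Suc k)) (i + length w) (j + length w) \<longleftrightarrow> run_in (str_power w k) i j"
proof -
  have "window w (i + length w - 1) (j + length w) = window w (i - 1) j"
    using window_shift[of "i - 1" w j] assms by simp
  moreover have "window w (i + length w) (j + length w + 1) = window w i (j + 1)"
    using window_shift[of i w "j + 1"] assms by (simp add: ac_simps)
  moreover have "window w (i + length w) (j + length w) = window w i j"
    using window_shift[of i w j] assms by simp
  ultimately show ?thesis
    using assms by (simp add: run_in_str_power_iff)
qed

section \<open>Counting runs by starting position\<close>

text \<open>The gain from one more factor is \<open>card ?B - card ?A\<close>, in which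
  \<open>k\<close> does not occur; both sides are sums to avoid truncated subtraction. Runs of the
  longer power starting after \<open>Suc ?m\<close> are shifts of runs of the shorter one starting
  after 1, so only early starts matter.\<close>

lemma num_runs_str_power_Suc:
  assumes w: "w \<noteq> []" and k: "k \<ge> 2"
  shows "num_runs (str_power w (Suc k)) + card {(i, j). power_run w i j \<and> i = 1 \<and> j < 2 * length w} =
    num_runs (str_power w k) +
      card {(i, j). power_run w i j \<and> i \<le> Suc (length w) \<and> j < 3 * length w}"
    (is "_ + card ?A = _ + card ?B")
proof -
  let ?m = "length w"
  let ?S = "\<lambda>k. {(i, j). run_in (str_power w k) i j}"
  have m: "?m > 0" using w by simp
  have k2: "2 * ?m \<le> k * ?m" and k3: "3 * ?m \<le> Suc k * ?m"
    using k by (auto intro: mult_le_mono1 simp del: mult_Suc)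
  have finA: "finite ?A"
    by (rule finite_subset[of _ "{1} \<times> {..<2 * ?m}"]) auto
  have finB: "finite ?B"
    by (rule finite_subset[of _ "{..Suc ?m} \<times> {..<3 * ?m}"]) auto
  have fin: "finite {x \<in> ?S k. P x}" for k P
    using finite_runs by (rule finite_subset[rotated]) auto
  have split: "num_runs (str_power w k) =
      card {x \<in> ?S k. fst x \<le> a} + card {x \<in> ?S k. a < fst x}" for k a
  proof -
    have "?S k = {x \<in> ?S k. fst x \<le> a} \<union> {x \<in> ?S k. a < fst x}"
      by auto
    then have "num_runs (str_power w k) = card ({x \<in> ?S k. fst x \<le> a} \<union> {x \<in> ?S k. a < fst x})"
      unfolding num_runs_def by (rule arg_cong)
    also have "\<dots> = card {x \<in> ?S k. fst x \<le> a} + card {x \<in> ?S k. a < fst x}"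
      by (intro card_Un_disjoint fin) auto
    finally show ?thesis .
  qed

  \<comment> \<open>Apart from the whole word, a run starting at 1 is short, so
    \<open>j < 2 * ?m \<le> k * ?m\<close>: it stops before the end and \<open>power_run\<close>
    describes it.\<close>
  have "{x \<in> ?S k. fst x \<le> 1} = insert (1, k * ?m) ?A"
  proof (intro subset_antisym subrelI)
    fix i j assume "(i, j) \<in> {x \<in> ?S k. fst x \<le> 1}"
    then have r: "run_in (str_power w k) i j" "i \<le> 1" by auto
    then have i: "i = 1" by (auto simp: run_in_def)
    show "(i, j) \<in> insert (1, k * ?m) ?A"
    proof (rule ccontr)
      assume n: "\<not> ?thesis"
      then have "(i, j) \<noteq> (1, k * ?m)" by auto
      from run_in_str_power_short[OF w r(1) this] have "j < 2 * ?m" using i by simp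
      moreover from this have "j < k * ?m" using k2 by linarith
      ultimately show False using r i n run_in_str_power_interior[of j k w i] by auto
    qed
  next
    fix i j assume "(i, j) \<in> insert (1, k * ?m) ?A"
    then show "(i, j) \<in> {x \<in> ?S k. fst x \<le> 1}"
      using run_in_str_power_full[OF w k] run_in_str_power_interior[of j k w i]
        less_le_trans[OF _ k2, of j] by auto
  qed
  moreover have "(1, k * ?m) \<notin> ?A"
    using k2 leD by blast
  ultimately have low: "card {x \<in> ?S k. fst x \<le> 1} = Suc (card ?A)"
    using finA by (simp only: card_insert_disjoint not_False_eq_True)

  \<comment> \<open>Here a start at most \<open>Suc ?m\<close> and a length below
    \<open>2 * ?m\<close> give \<open>j < 3 * ?m\<close>, still before the end.\<close>
  have "{x \<in> ?S (Suc k). fst x \<le> Suc ?m} = insert (1, Suc k * ?m) ?B"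
  proof (intro subset_antisym subrelI)
    fix i j assume "(i, j) \<in> {x \<in> ?S (Suc k). fst x \<le> Suc ?m}"
    then have r: "run_in (str_power w (Suc k)) i j" "i \<le> Suc ?m" by auto
    show "(i, j) \<in> insert (1, Suc k * ?m) ?B"
    proof (rule ccontr)
      assume n: "\<not> ?thesis"
      then have "(i, j) \<noteq> (1, Suc k * ?m)" by auto
      from run_in_str_power_short[OF w r(1) this] have "j < 3 * ?m" using r(2) by simp
      moreover from this have "j < Suc k * ?m" using k3 by linarith
      ultimately show False using r n run_in_str_power_interior[of j "Suc k" w i] by auto
    qed
  next
    fix i j assume "(i, j) \<in> insert (1, Suc k * ?m) ?B"
    then show "(i, j) \<in> {x \<in> ?S (Suc k). fst x \<le> Suc ?m}"
      using run_in_str_power_full[OF w, of "Suc k"] k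
        run_in_str_power_interior[of j "Suc k" w i] less_le_trans[OF _ k3, of j] by auto
  qed
  moreover have "(1, Suc k * ?m) \<notin> ?B"
    using k3 leD by blast
  ultimately have low': "card {x \<in> ?S (Suc k). fst x \<le> Suc ?m} = Suc (card ?B)"
    using finB by (simp only: card_insert_disjoint not_False_eq_True)

  have "bij_betw (\<lambda>(i, j). (i + ?m, j + ?m)) {x \<in> ?S k. 1 < fst x} {x \<in> ?S (Suc k). Suc ?m < fst x}"
  proof (rule bij_betw_imageI)
    show "(\<lambda>(i, j). (i + ?m, j + ?m)) ` {x \<in> ?S k. 1 < fst x} = {x \<in> ?S (Suc k). Suc ?m < fst x}"
    proof (intro set_eqI iffI)
      fix x assume x: "x \<in> {x \<in> ?S (Suc k). Suc ?m < fst x}"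
      define i j where "i = fst x - ?m" and "j = snd x - ?m"
      have "fst x \<le> snd x" using x by (auto simp: run_in_def)
      then have xij: "x = (i + ?m, j + ?m)" and i: "1 < i"
        using x by (auto simp: i_def j_def prod_eq_iff)
      then have "(i, j) \<in> {x \<in> ?S k. 1 < fst x}"
        using x run_in_str_power_shift[OF i] by auto
      then show "x \<in> (\<lambda>(i, j). (i + ?m, j + ?m)) ` {x \<in> ?S k. 1 < fst x}"
        using xij by force
    qed (auto simp: run_in_str_power_shift)
  qed (auto simp: inj_on_def)
  then have high: "card {x \<in> ?S k. 1 < fst x} = card {x \<in> ?S (Suc k). Suc ?m < fst x}"
    by (rule bij_betw_same_card)

  \<comment> \<open>The whole word contributes one \<open>Suc\<close> to each count, and these
    cancel.\<close>
  show ?thesis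
    using split[of k 1] split[of "Suc k" "Suc ?m"] low low' high by simp
qed

text \<open>The constant gain, summed up; integers keep the difference from being truncated.\<close>

lemma num_runs_str_power:
  assumes w: "w \<noteq> []"
  shows "int (num_runs (str_power w (k + 2))) = int (num_runs (str_power w 2)) +
    int k * (int (num_runs (str_power w 3)) - int (num_runs (str_power w 2)))"
proof (induction k)
  case (Suc k)
  \<comment> \<open>The two cardinalities are the same at exponents \<open>k + 2\<close> and 2, so
    the increments agree.\<close>
  have "int (num_runs (str_power w (Suc (k + 2)))) - int (num_runs (str_power w (k + 2))) =
      int (num_runs (str_power w 3)) - int (num_runs (str_power w 2))"
    using num_runs_str_power_Suc[OF w, of "k + 2"] num_runs_str_power_Suc[OF w, of 2] by simp
  then show ?case
    using Suc by (simp add: algebra_simps)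
qed (simp add: numeral_2_eq_2)

section \<open>Passage to arbitrary lengths\<close>

theorem theorem2:
  fixes w :: "'a list" and \<epsilon> :: real
  assumes "w \<noteq> []" and "\<epsilon> > 0"
  shows "\<exists>N::nat. N > 0 \<and> (\<forall>n\<ge>N. real (max_runs n) / real n >
           (real (num_runs (str_power w 3)) - real (num_runs (str_power w 2))) / real (length w) - \<epsilon>)"
proof -
  define m where "m = length w"
  define D where "D = real (num_runs (str_power w 3)) - real (num_runs (str_power w 2))"
  have m: "m > 0" using assms(1) by (simp add: m_def)
  \<comment> \<open>Rounding \<open>n\<close> down to a multiple of \<open>m\<close> and starting
    from exponent 2 costs at most \<open>3 * D\<close> runs; beyond \<open>N0\<close> this is less
    than \<open>\<epsilon> * n\<close>.\<close>
  obtain N0 :: nat where N0: "real N0 > 3 * D / \<epsilon>"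
    using reals_Archimedean2 by blast
  have "real (max_runs n) / real n > D / real m - \<epsilon>" if n: "n \<ge> max N0 (2 * m)" for n
  proof (cases "D \<ge> 0")
    \<comment> \<open>For negative \<open>D\<close> the bound is trivial; the main estimate
      multiplies by \<open>D\<close> and needs its sign.\<close>
    case False
    then have "D / real m < 0" using m by (simp add: divide_neg_pos)
    moreover have "real (max_runs n) / real n \<ge> 0" by simp
    ultimately show ?thesis using assms(2) by linarith
  next
    case True
    have n0: "real n > 0" using n m by simp
    \<comment> \<open>At least two copies of \<open>w\<close> fit into length \<open>n\<close>, so
      the exponent has the form \<open>k + 2\<close>.\<close>
    have "2 * m div m \<le> n div m" using n by (intro div_le_mono) simp
    then have "2 \<le> n div m" using m by simp
    then obtain k where k: "n div m = k + 2" using le_Suc_ex add.commute by metis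
    have "real n < real ((k + 3) * m)"
    proof -
      have "n = (k + 2) * m + n mod m" using k div_mult_mod_eq[of n m] by simp
      moreover have "n mod m < m" using m by simp
      ultimately have "n < (k + 3) * m" by (simp add: algebra_simps)
      then show ?thesis by (simp only: of_nat_less_iff)
    qed
    then have k3: "real n / real m - 3 \<le> real k" using m by (simp add: field_simps)
    have "3 * D < \<epsilon> * real n"
    proof -
      have "3 * D / \<epsilon> < real n" using N0 n by simp
      then show ?thesis using assms(2) by (simp add: field_simps)
    qed
    then have "(D / real m - \<epsilon>) * real n < (real n / real m - 3) * D"
      by (simp add: algebra_simps)
    also have "\<dots> \<le> real k * D"
      using k3 True by (rule mult_right_mono)
    \<comment> \<open>Drops the nonnegative term \<open>num_runs (str_power w 2)\<close>.\<close>
    also have "\<dots> \<le> real (num_runs (str_power w (k + 2)))"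
    proof -
      have "real_of_int (int (num_runs (str_power w (k + 2)))) =
          real (num_runs (str_power w 2)) + real k * D"
        unfolding num_runs_str_power[OF assms(1)] D_def by simp
      then show ?thesis by simp
    qed
    also have "\<dots> \<le> real (max_runs n)"
    proof -
      have "length (str_power w (k + 2)) \<le> n"
        unfolding length_str_power m_def[symmetric] k[symmetric] by simp
      then show ?thesis using num_runs_le_max_runs_length by simp
    qed
    finally show ?thesis using n0 by (simp add: field_simps)
  qed
  then show ?thesis
    using m unfolding D_def m_def by (intro exI[of _ "max N0 (2 * length w)"]) (auto simp: less_max_iff_disj)
qed

end
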